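(* Let $G$ be a compact Lie group, let $V$ be a real representation of $G$ of dimension $n\ge 1$ equipped with a $G$-invariant scalar product $\langle\cdot,\cdot\rangle$, and let $S(V)$ be the unit sphere of $V$. (i) For independent invariant random vectors $x,y$ defined on any invariant probability subspace $\mathcal{U}\subset S(V)$, $$\mathbb{E}(\langle x,y\rangle^2)\ \ge\ \frac1n .$$ (ii) If the representation of $G$ in $V$ is irreducible, then for independent invariant random vectors $x,y$ defined on any invariant probability subspace $\mathcal{U}\subset S(V)$, $$\mathbb{E}(\langle x,y\rangle^2)\ =\ \frac1n .$$ (iii) If there is a non-trivial $G$-invariant linear subspace $W\subset V$ (that is, $0<\dim W<n$), then there is an invariant probability subspace $\mathcal{U}\subset S(V)$ and independent invariant random vectors $x,y$ defined on $\mathcal{U}$ such that $$\mathbb{E}(\langle x,y\rangle^2)\ >\ \frac1n .$$ Consequently, the real representation $V$ of $G$ is irreducible if and only if $\mathbb{E}(\langle x,y\rangle^2)=1/n$ for any independent invariant random vectors $x,y$ defined on any invariant probability subspace of the unit sphere $S(V)$.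
   Context: An invariant probability subspace of $V$ is a $G$-invariant subset $\mathcal{U}\subset V$ together with a Radon probability measure $\mu$ on $\mathcal{U}$ that is $G$-invariant, i.e. $\mu(g\,\mathcal{U}')=\mu(\mathcal{U}')$ for every measurable $\mathcal{U}'\subset\mathcal{U}$ and every $g\in G$. An invariant random vector defined on the invariant probability subspace $(\mathcal{U},\mu)$ is a random vector with values in $\mathcal{U}$ distributed according to $\mu$. When two independent invariant random vectors $x,y$ are defined on $(\mathcal{U},\mu)$, both have law $\mu$. $\mathbb{E}$ denotes expectation. *)

theory Defs
  imports "HOL-Probability.Probability" "HOL-Algebra.Group_Action"
begin

section \<open>Lie groups\<close>

text \<open>
  \<open>R^d\<close> is the library's topology \<^const>\<open>Euclidean_space\<close> \<open>d\<close>, whose points are the sequences vanishing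
  from index \<open>d\<close> on; in contrast to the type class \<^class>\<open>euclidean_space\<close> this includes \<open>d = 0\<close>, hence
  finite (and all discrete) Lie groups. \<open>C_on k d S f\<close> says that all iterated partial derivatives of
  \<open>f\<close> up to order \<open>k\<close> exist and are continuous on \<open>S\<close>. It is only meaningful for \<open>S\<close> open in \<open>R^d\<close>, which
  \<open>smooth_on\<close> below requires.
\<close>

primrec C_on :: "nat \<Rightarrow> nat \<Rightarrow> (nat \<Rightarrow> real) set \<Rightarrow> ((nat \<Rightarrow> real) \<Rightarrow> real) \<Rightarrow> bool" where
  "C_on 0 d S f \<longleftrightarrow> continuous_map (subtopology (Euclidean_space d) S) euclideanreal f"
| "C_on (Suc k) d S f \<longleftrightarrow>
     continuous_map (subtopology (Euclidean_space d) S) euclideanreal f \<and>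
     (\<forall>i<d. \<exists>f'. (\<forall>x\<in>S. ((\<lambda>t. f (x(i := t))) has_real_derivative f' x) (at (x i))) \<and>
                 C_on k d S f')"

definition smooth_on :: "nat \<Rightarrow> (nat \<Rightarrow> real) set \<Rightarrow> ((nat \<Rightarrow> real) \<Rightarrow> nat \<Rightarrow> real) \<Rightarrow> bool" where
  "smooth_on d S F \<longleftrightarrow> openin (Euclidean_space d) S \<and> (\<forall>k j. C_on k d S (\<lambda>x. F x j))"

type_synonym 'a chart = "'a set \<times> ('a \<Rightarrow> nat \<Rightarrow> real)"

definition smooth_atlas :: "nat \<Rightarrow> 'a topology \<Rightarrow> 'a chart set \<Rightarrow> bool" where
  "smooth_atlas d T A \<longleftrightarrow>
     (\<Union>(U, \<phi>)\<in>A. U) = topspace T \<and>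
     (\<forall>(U, \<phi>)\<in>A. openin T U \<and> openin (Euclidean_space d) (\<phi> ` U) \<and>
        homeomorphic_map (subtopology T U) (subtopology (Euclidean_space d) (\<phi> ` U)) \<phi>) \<and>
     (\<forall>(U, \<phi>)\<in>A. \<forall>(V, \<psi>)\<in>A. smooth_on d (\<phi> ` (U \<inter> V)) (\<psi> \<circ> inv_into U \<phi>))"

definition smooth_manifold :: "nat \<Rightarrow> 'a topology \<Rightarrow> 'a chart set \<Rightarrow> bool" where
  "smooth_manifold d T A \<longleftrightarrow>
     Hausdorff_space T \<and> second_countable T \<and> smooth_atlas d T A"

definition smooth_map ::
  "nat \<Rightarrow> 'a topology \<Rightarrow> 'a chart set \<Rightarrow> 'b topology \<Rightarrow> 'b chart set \<Rightarrow> ('a \<Rightarrow> 'b) \<Rightarrow> bool" where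
  "smooth_map d S A T B f \<longleftrightarrow>
     continuous_map S T f \<and>
     (\<forall>(U, \<phi>)\<in>A. \<forall>(V, \<psi>)\<in>B. smooth_on d (\<phi> ` (U \<inter> f -` V)) (\<psi> \<circ> f \<circ> inv_into U \<phi>))"

text \<open>\<open>R^d \<times> R^e\<close> is identified with \<open>R^(d + e)\<close> by concatenation of coordinates.\<close>

definition prod_atlas :: "nat \<Rightarrow> 'a chart set \<Rightarrow> 'b chart set \<Rightarrow> ('a \<times> 'b) chart set" where
  "prod_atlas d A B =
     {(U \<times> V, \<lambda>(x, y) i. if i < d then \<phi> x i else \<psi> y (i - d)) | U \<phi> V \<psi>.
        (U, \<phi>) \<in> A \<and> (V, \<psi>) \<in> B}"

definition lie_group :: "nat \<Rightarrow> ('g, 'm) monoid_scheme \<Rightarrow> 'g topology \<Rightarrow> 'g chart set \<Rightarrow> bool" where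
  "lie_group d G T A \<longleftrightarrow>
     group G \<and> carrier G = topspace T \<and> smooth_manifold d T A \<and>
     smooth_map (d + d) (prod_topology T T) (prod_atlas d A A) T A (\<lambda>(g, h). g \<otimes>\<^bsub>G\<^esub> h) \<and>
     smooth_map d T A T A (\<lambda>g. inv\<^bsub>G\<^esub> g)"

definition compact_lie_group ::
  "nat \<Rightarrow> ('g, 'm) monoid_scheme \<Rightarrow> 'g topology \<Rightarrow> 'g chart set \<Rightarrow> bool" where
  "compact_lie_group d G T A \<longleftrightarrow> lie_group d G T A \<and> compact_space T"


section \<open>Real representations\<close>

text \<open>
  A type of class \<^class>\<open>euclidean_space\<close> is an arbitrary real vector space of finite dimension
  \<open>DIM('v) \<ge> 1\<close> with a scalar product, and carries the topology of that scalar product.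
\<close>

definition real_representation ::
  "('g, 'm) monoid_scheme \<Rightarrow> 'g topology \<Rightarrow> ('g \<Rightarrow> 'v::euclidean_space \<Rightarrow> 'v) \<Rightarrow> bool" where
  "real_representation G T \<rho> \<longleftrightarrow>
     group_action G UNIV \<rho> \<and> (\<forall>g\<in>carrier G. linear (\<rho> g)) \<and>
     continuous_map (prod_topology T euclidean) euclidean (\<lambda>(g, v). \<rho> g v)"

definition invariant_scalar_product ::
  "('g, 'm) monoid_scheme \<Rightarrow> ('g \<Rightarrow> 'v::real_inner \<Rightarrow> 'v) \<Rightarrow> bool" where
  "invariant_scalar_product G \<rho> \<longleftrightarrow> (\<forall>g\<in>carrier G. \<forall>v w. \<rho> g v \<bullet> \<rho> g w = v \<bullet> w)"

definition invariant_set :: "('g, 'm) monoid_scheme \<Rightarrow> ('g \<Rightarrow> 'v \<Rightarrow> 'v) \<Rightarrow> 'v set \<Rightarrow> bool" where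
  "invariant_set G \<rho> U \<longleftrightarrow> (\<forall>g\<in>carrier G. \<forall>u\<in>U. \<rho> g u \<in> U)"

definition irreducible_representation ::
  "('g, 'm) monoid_scheme \<Rightarrow> ('g \<Rightarrow> 'v::real_vector \<Rightarrow> 'v) \<Rightarrow> bool" where
  "irreducible_representation G \<rho> \<longleftrightarrow>
     (UNIV :: 'v set) \<noteq> {0} \<and>
     (\<forall>W. subspace W \<and> invariant_set G \<rho> W \<longrightarrow> W = {0} \<or> W = UNIV)"


section \<open>Invariant probability subspaces and invariant random vectors\<close>

text \<open>
  The invariant set \<open>U\<close> need not be measurable; \<open>\<mu>\<close> lives on the Borel sigma-algebra of the subspace
  \<open>U\<close>, and \<^prop>\<open>space \<mu> = U\<close> follows. For a finite Borel measure on a Hausdorff space, being Radon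
  amounts to inner regularity with respect to compact sets.
\<close>

definition radon_probability_on :: "'v::topological_space set \<Rightarrow> 'v measure \<Rightarrow> bool" where
  "radon_probability_on U \<mu> \<longleftrightarrow>
     sets \<mu> = sets (restrict_space borel U) \<and> prob_space \<mu> \<and>
     (\<forall>B\<in>sets \<mu>. emeasure \<mu> B = (SUP K\<in>{K. compact K \<and> K \<subseteq> B}. emeasure \<mu> K))"

definition invariant_probability_subspace ::
  "('g, 'm) monoid_scheme \<Rightarrow> ('g \<Rightarrow> 'v::euclidean_space \<Rightarrow> 'v) \<Rightarrow> 'v set \<Rightarrow> 'v measure \<Rightarrow> bool" where
  "invariant_probability_subspace G \<rho> U \<mu> \<longleftrightarrow>
     invariant_set G \<rho> U \<and> radon_probability_on U \<mu> \<and>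
     (\<forall>g\<in>carrier G. \<forall>B\<in>sets \<mu>. emeasure \<mu> (\<rho> g ` B) = emeasure \<mu> B)"

text \<open>\<open>M\<close> is the sample space; \<open>x\<close> takes values in \<^term>\<open>space \<mu>\<close>.\<close>

definition invariant_random_vector :: "'w measure \<Rightarrow> 'v measure \<Rightarrow> ('w \<Rightarrow> 'v) \<Rightarrow> bool" where
  "invariant_random_vector M \<mu> x \<longleftrightarrow> x \<in> measurable M \<mu> \<and> distr M \<mu> x = \<mu>"

definition independent_invariant_random_vectors ::
  "'w measure \<Rightarrow> 'v measure \<Rightarrow> ('w \<Rightarrow> 'v) \<Rightarrow> ('w \<Rightarrow> 'v) \<Rightarrow> bool" where
  "independent_invariant_random_vectors M \<mu> x y \<longleftrightarrow>
     prob_space M \<and> invariant_random_vector M \<mu> x \<and> invariant_random_vector M \<mu> y \<and>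
     prob_space.indep_var M \<mu> x \<mu> y"

end

theory Submission
  imports Defs
begin

text \<open>
  For independent \<open>x, y\<close> with the same law \<open>\<mu>\<close> on the unit sphere, the mean of \<open>\<langle>x, y\<rangle>\<^sup>2\<close> depends
  only on the second moment form \<open>m v w = E(\<langle>x, v\<rangle>\<langle>x, w\<rangle>)\<close>. Expanding in
  an orthonormal basis and using independence gives \<open>E(\<langle>x, y\<rangle>\<^sup>2) = \<Sum>b c. (m b c)\<^sup>2\<close>
  (\<open>expectation_inner_squared\<close>), while \<open>\<parallel>x\<parallel> = 1\<close> means that \<open>m\<close> has trace \<open>1\<close>
  (\<open>trace_second_moment\<close>). A form of trace \<open>1\<close> on a space of dimension \<open>k\<close> has squared
  Hilbert--Schmidt norm at least \<open>1 / k\<close> by Cauchy--Schwarz, with equality for the multiple \<open>1 / k\<close>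
  of the scalar product.

  The basis only has to span a subspace that contains the support of \<open>\<mu>\<close>, and this is what makes the
  bound serve twice. On the whole space it is the lower bound \<open>1 / n\<close>. For a law carried by a proper
  invariant subspace \<open>W\<close> it is \<open>1 / dim W\<close>, which exceeds \<open>1 / n\<close>.

  If \<open>\<mu>\<close> is invariant, so is \<open>m\<close>, and irreducibility forces \<open>m\<close> to be a multiple of the scalar
  product (\<open>invariant_form_proportional_to_inner\<close>), hence equality. In the reducible case there remains
  to exhibit some invariant law on the unit sphere of \<open>W\<close>
  (\<open>invariant_law_on_subspace_sphere\<close>): projecting a uniform point of the unit ball to \<open>W\<close> and
  normalising it works, since Lebesgue measure is invariant under orthogonal maps
  (\<open>emeasure_lborel_orthogonal_vimage\<close>).
\<close>

section \<open>Second moments of laws on the unit sphere\<close>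

definition second_moment :: "'v::real_inner measure \<Rightarrow> 'v \<Rightarrow> 'v \<Rightarrow> real" where
  "second_moment \<mu> v w = (\<integral>x. (x \<bullet> v) * (x \<bullet> w) \<partial>\<mu>)"

locale unit_sphere_law = prob_space \<mu> for \<mu> :: "'v::euclidean_space measure" +
  fixes U :: "'v set"
  assumes sets_law: "sets \<mu> = sets (restrict_space borel U)"
    and unit: "U \<subseteq> sphere 0 1"
begin

lemma space_law: "space \<mu> = U"
  using sets_eq_imp_space_eq[OF sets_law] by (simp add: space_restrict_space)

lemma borel_measurable_law: "f \<in> borel_measurable borel \<Longrightarrow> f \<in> measurable \<mu> borel"
  using measurable_cong_sets[OF sets_law refl] measurable_restrict_space1 by blast

lemma integrable_inner_products: "integrable \<mu> (\<lambda>x. (x \<bullet> v) * (x \<bullet> w))"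
proof (rule integrable_const_bound[where B = "norm v * norm w"])
  show "AE x in \<mu>. norm ((x \<bullet> v) * (x \<bullet> w)) \<le> norm v * norm w"
  proof (rule AE_I2)
    fix x assume "x \<in> space \<mu>"
    then have "norm x = 1"
      using unit by (auto simp: space_law)
    then have "\<bar>x \<bullet> v\<bar> \<le> norm v" "\<bar>x \<bullet> w\<bar> \<le> norm w"
      using Cauchy_Schwarz_ineq2[of x v] Cauchy_Schwarz_ineq2[of x w] by auto
    then show "norm ((x \<bullet> v) * (x \<bullet> w)) \<le> norm v * norm w"
      by (simp add: abs_mult mult_mono)
  qed
  show "(\<lambda>x. (x \<bullet> v) * (x \<bullet> w)) \<in> borel_measurable \<mu>"
    by (rule borel_measurable_law) measurable
qed

lemma second_moment_commute: "second_moment \<mu> v w = second_moment \<mu> w v"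
  by (simp add: second_moment_def mult.commute)

lemma bilinear_second_moment: "bilinear (second_moment \<mu>)"
proof -
  have "linear (second_moment \<mu> v)" for v
  proof (rule linearI)
    show "second_moment \<mu> v (w1 + w2) = second_moment \<mu> v w1 + second_moment \<mu> v w2" for w1 w2
      by (simp add: second_moment_def inner_add_right distrib_left integrable_inner_products)
    have "second_moment \<mu> v (r *\<^sub>R w) = (\<integral>x. r * ((x \<bullet> v) * (x \<bullet> w)) \<partial>\<mu>)" for r w
      unfolding second_moment_def by (intro Bochner_Integration.integral_cong) auto
    then show "second_moment \<mu> v (r *\<^sub>R w) = r *\<^sub>R second_moment \<mu> v w" for r w
      by (simp add: second_moment_def)
  qed
  then show ?thesis
    using second_moment_commute by (auto simp: bilinear_def)
qed

text \<open>
  Parseval on the sphere: the squares of the coordinates of a unit vector add up to \<open>1\<close>.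
\<close>
lemma trace_second_moment:
  assumes "finite B" "pairwise orthogonal B" "\<And>b. b \<in> B \<Longrightarrow> norm b = 1" "U \<subseteq> span B"
  shows "(\<Sum>b\<in>B. second_moment \<mu> b b) = 1"
proof -
  have "(\<Sum>b\<in>B. second_moment \<mu> b b) = (\<integral>x. (\<Sum>b\<in>B. (x \<bullet> b) * (x \<bullet> b)) \<partial>\<mu>)"
    by (simp add: second_moment_def Bochner_Integration.integral_sum integrable_inner_products)
  also have "\<dots> = (\<integral>x. 1 \<partial>\<mu>)"
  proof (rule Bochner_Integration.integral_cong[OF refl])
    fix x assume x: "x \<in> space \<mu>"
    then have "x \<in> span B" "norm x = 1"
      using assms(4) unit by (auto simp: space_law)
    then have "x \<bullet> (\<Sum>b\<in>B. (x \<bullet> b) *\<^sub>R b) = 1"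
      using assms orthonormal_basis_expand[of B x] by (simp add: dot_square_norm)
    then show "(\<Sum>b\<in>B. (x \<bullet> b) * (x \<bullet> b)) = 1"
      by (simp add: inner_sum_right)
  qed
  finally show ?thesis
    by (simp add: prob_space)
qed

text \<open>
  Expanding \<open>\<langle>x, y\<rangle>\<^sup>2\<close> in coordinates separates \<open>x\<close> from \<open>y\<close>, so that independence turns the
  expectation into the squared Hilbert--Schmidt norm of the second moment form.
\<close>
lemma expectation_inner_squared:
  assumes B: "finite B" "pairwise orthogonal B" "\<And>b. b \<in> B \<Longrightarrow> norm b = 1" "U \<subseteq> span B"
    and ind: "independent_invariant_random_vectors M \<mu> X Y"
  shows "prob_space.expectation M (\<lambda>\<omega>. (X \<omega> \<bullet> Y \<omega>)\<^sup>2) =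
    (\<Sum>b\<in>B. \<Sum>c\<in>B. (second_moment \<mu> b c)\<^sup>2)"
proof -
  interpret M: prob_space M
    using ind by (simp add: independent_invariant_random_vectors_def)
  have X: "X \<in> measurable M \<mu>" "distr M \<mu> X = \<mu>" and Y: "Y \<in> measurable M \<mu>" "distr M \<mu> Y = \<mu>"
    and indep: "M.indep_var \<mu> X \<mu> Y"
    using ind by (auto simp: independent_invariant_random_vectors_def invariant_random_vector_def)
  define q where "q b c x = (x \<bullet> b) * (x \<bullet> c)" for b c x :: 'v
  have q: "q b c \<in> borel_measurable \<mu>" for b c
    unfolding q_def by (rule borel_measurable_law) measurable
  have int: "integrable M (\<lambda>\<omega>. q b c (X \<omega>))" "integrable M (\<lambda>\<omega>. q b c (Y \<omega>))" for b c
    using integrable_distr_eq[OF X(1) q, of b c] integrable_distr_eq[OF Y(1) q, of b c]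
      integrable_inner_products[of b c]
    by (simp_all add: X(2) Y(2) q_def[abs_def])
  have mom: "(\<integral>\<omega>. q b c (X \<omega>) \<partial>M) = second_moment \<mu> b c"
    "(\<integral>\<omega>. q b c (Y \<omega>) \<partial>M) = second_moment \<mu> b c" for b c
    using integral_distr[OF X(1) q, of b c] integral_distr[OF Y(1) q, of b c] X(2) Y(2)
    by (simp_all add: q_def[abs_def] second_moment_def)
  have ind_q: "M.indep_var borel (\<lambda>\<omega>. q b c (X \<omega>)) borel (\<lambda>\<omega>. q b c (Y \<omega>))" for b c
    using M.indep_var_compose[OF indep q q, of b c b c] by (simp add: comp_def)
  have prod: "(\<integral>\<omega>. q b c (X \<omega>) * q b c (Y \<omega>) \<partial>M) = (second_moment \<mu> b c)\<^sup>2"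
    "integrable M (\<lambda>\<omega>. q b c (X \<omega>) * q b c (Y \<omega>))" for b c
    using M.indep_var_lebesgue_integral[OF ind_q int, of b c]
      M.indep_var_integrable[OF ind_q int, of b c]
    by (simp_all add: mom power2_eq_square)
  have "(\<integral>\<omega>. (X \<omega> \<bullet> Y \<omega>)\<^sup>2 \<partial>M) =
    (\<integral>\<omega>. (\<Sum>b\<in>B. \<Sum>c\<in>B. q b c (X \<omega>) * q b c (Y \<omega>)) \<partial>M)"
  proof (rule Bochner_Integration.integral_cong[OF refl])
    fix \<omega> assume "\<omega> \<in> space M"
    then have "X \<omega> \<in> span B"
      using measurable_space[OF X(1)] B(4) by (auto simp: space_law)
    then have "X \<omega> \<bullet> Y \<omega> = (\<Sum>b\<in>B. (X \<omega> \<bullet> b) *\<^sub>R b) \<bullet> Y \<omega>"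
      using B orthonormal_basis_expand[of B "X \<omega>"] by simp
    also have "\<dots> = (\<Sum>b\<in>B. (X \<omega> \<bullet> b) * (Y \<omega> \<bullet> b))"
      by (simp add: inner_sum_right inner_commute[of _ "Y \<omega>"])
    finally show "(X \<omega> \<bullet> Y \<omega>)\<^sup>2 = (\<Sum>b\<in>B. \<Sum>c\<in>B. q b c (X \<omega>) * q b c (Y \<omega>))"
      by (simp add: power2_eq_square sum_product q_def mult_ac)
  qed
  also have "\<dots> = (\<Sum>b\<in>B. \<Sum>c\<in>B. (second_moment \<mu> b c)\<^sup>2)"
    by (simp add: Bochner_Integration.integral_sum prod)
  finally show ?thesis .
qed

text \<open>
  Dropping the off-diagonal terms leaves the squares of the diagonal entries; these sum to the
  trace \<open>1\<close>, and Cauchy--Schwarz bounds the sum of their squares from below.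
\<close>
lemma expectation_inner_squared_ge:
  assumes B: "finite B" "pairwise orthogonal B" "\<And>b. b \<in> B \<Longrightarrow> norm b = 1" "U \<subseteq> span B"
    and ind: "independent_invariant_random_vectors M \<mu> X Y"
  shows "1 / real (card B) \<le> prob_space.expectation M (\<lambda>\<omega>. (X \<omega> \<bullet> Y \<omega>)\<^sup>2)"
proof -
  have "1 = (\<Sum>b\<in>B. second_moment \<mu> b b * 1)\<^sup>2"
    using trace_second_moment[OF B] by simp
  also have "\<dots> \<le> (\<Sum>b\<in>B. (second_moment \<mu> b b)\<^sup>2) * (\<Sum>b\<in>B. 1\<^sup>2)"
    by (rule Cauchy_Schwarz_ineq_sum)
  finally have "1 / real (card B) \<le> (\<Sum>b\<in>B. (second_moment \<mu> b b)\<^sup>2)"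
    by (cases "card B = 0") (auto simp: divide_simps sum_nonneg)
  also have "\<dots> \<le> (\<Sum>b\<in>B. \<Sum>c\<in>B. (second_moment \<mu> b c)\<^sup>2)"
    using B(1) by (intro sum_mono member_le_sum) auto
  finally show ?thesis
    by (simp add: expectation_inner_squared[OF B ind])
qed

text \<open>
  A form proportional to the scalar product is determined by its trace, and the trace is \<open>1\<close>.
\<close>
lemma expectation_inner_squared_isotropic:
  assumes iso: "\<And>v w. second_moment \<mu> v w = r * (v \<bullet> w)"
    and ind: "independent_invariant_random_vectors M \<mu> X Y"
  shows "prob_space.expectation M (\<lambda>\<omega>. (X \<omega> \<bullet> Y \<omega>)\<^sup>2) = 1 / real DIM('v)"
proof -
  have B: "finite (Basis :: 'v set)" "pairwise orthogonal (Basis :: 'v set)"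
    "\<And>b. b \<in> (Basis :: 'v set) \<Longrightarrow> norm b = 1" "U \<subseteq> span Basis"
    by (auto simp: pairwise_def orthogonal_def inner_Basis)
  have "(\<Sum>b\<in>Basis. second_moment \<mu> b b) = real DIM('v) * r"
    by (simp add: iso)
  then have r: "real DIM('v) * r = 1"
    using trace_second_moment[OF B] by simp
  have "(second_moment \<mu> b c)\<^sup>2 = (if c = b then r\<^sup>2 else 0)" if "b \<in> Basis" "c \<in> Basis" for b c
    using that by (auto simp: iso inner_Basis)
  then have "(\<Sum>b\<in>Basis. \<Sum>c\<in>Basis. (second_moment \<mu> b c)\<^sup>2) = real DIM('v) * r\<^sup>2"
    by simp
  also have "\<dots> = 1 / real DIM('v)"
    using r by (simp add: power2_eq_square field_simps)
  finally show ?thesis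
    by (simp add: expectation_inner_squared[OF B ind])
qed

end

section \<open>Invariant symmetric forms\<close>

text \<open>
  By the parallelogram law, \<open>p (v + w) (v + w) + p (v - w) (v - w)\<close> vanishes together with
  \<open>p v v\<close> and \<open>p w w\<close>, and both summands are nonnegative.
\<close>
lemma subspace_isotropic_vectors:
  fixes p :: "'v::real_vector \<Rightarrow> 'v \<Rightarrow> real"
  assumes p: "bilinear p" and nonneg: "\<And>v. 0 \<le> p v v"
  shows "subspace {v. p v v = 0}"
proof (rule subspaceI)
  show "0 \<in> {v. p v v = 0}"
    by (simp add: bilinear_lzero[OF p])
next
  fix v w assume vw: "v \<in> {v. p v v = 0}" "w \<in> {v. p v v = 0}"
  have "p (v + w) (v + w) + p (v - w) (v - w) = 2 * p v v + 2 * p w w"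
    by (simp add: bilinear_ladd[OF p] bilinear_radd[OF p] bilinear_lsub[OF p] bilinear_rsub[OF p])
  then show "v + w \<in> {v. p v v = 0}"
    using vw nonneg[of "v + w"] nonneg[of "v - w"] by simp
next
  fix r v assume "v \<in> {v. p v v = 0}"
  then show "r *\<^sub>R v \<in> {v. p v v = 0}"
    by (simp add: bilinear_lmul[OF p] bilinear_rmul[OF p])
qed

text \<open>
  Schur's lemma for symmetric forms. If \<open>r\<close> is the maximum of \<open>m v v\<close> on the unit sphere, then
  \<open>r \<parallel>v\<parallel>\<^sup>2 - m v v\<close> is a nonnegative invariant quadratic form. Its zeros form an invariant
  subspace, which contains a maximiser and is therefore the whole space.
\<close>
lemma invariant_form_proportional_to_inner:
  fixes m :: "'v::euclidean_space \<Rightarrow> 'v \<Rightarrow> real"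
  assumes irr: "irreducible_representation G \<rho>"
    and scal: "invariant_scalar_product G \<rho>"
    and m: "bilinear m" "\<And>v w. m v w = m w v"
    and inv: "\<And>g v. g \<in> carrier G \<Longrightarrow> m (\<rho> g v) (\<rho> g v) = m v v"
  obtains r where "\<And>v w. m v w = r * (v \<bullet> w)"
proof -
  have "continuous_on (sphere (0::'v) 1) (\<lambda>v. m v v)"
    by (rule bilinear_continuous_on_compose[OF _ _ m(1)]) (auto intro: continuous_intros)
  moreover have "sphere (0::'v) 1 \<noteq> {}"
    by simp
  ultimately obtain v0 where v0: "norm v0 = 1" "\<And>v. norm v = 1 \<Longrightarrow> m v v \<le> m v0 v0"
    using continuous_attains_sup[of "sphere (0::'v) 1" "\<lambda>v. m v v"] by auto
  define r where "r = m v0 v0"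
  define p where "p v w = r * (v \<bullet> w) - m v w" for v w
  have "bilinear (\<lambda>v w :: 'v. r * (v \<bullet> w))"
    by (auto simp: bilinear_def intro!: linearI simp: inner_add_left inner_add_right algebra_simps)
  then have p: "bilinear p"
    unfolding p_def using m(1) by (auto simp: bilinear_def intro!: linear_compose_sub)
  have nonneg: "0 \<le> p v v" for v
  proof (cases "v = 0")
    case True
    then show ?thesis by (simp add: bilinear_lzero[OF p])
  next
    case False
    define u where "u = v /\<^sub>R norm v"
    have "norm u = 1" "v = norm v *\<^sub>R u"
      using False by (auto simp: u_def)
    have "p u u \<ge> 0"
      using v0(2)[OF \<open>norm u = 1\<close>] \<open>norm u = 1\<close> by (simp add: p_def r_def dot_square_norm)
    moreover have "p v v = (norm v * norm v) * p u u"
      by (subst (1 2) \<open>v = norm v *\<^sub>R u\<close>) (simp only: bilinear_lmul[OF p] bilinear_rmul[OF p] real_scaleR_def mult.assoc)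
    ultimately show ?thesis by simp
  qed
  have "invariant_set G \<rho> {v. p v v = 0}"
    using inv scal by (auto simp: invariant_set_def invariant_scalar_product_def p_def)
  moreover have "v0 \<in> {v. p v v = 0}" "v0 \<noteq> 0"
    using v0(1) by (auto simp: p_def r_def dot_square_norm)
  ultimately have "{v. p v v = 0} = UNIV"
    using irr subspace_isotropic_vectors[OF p nonneg]
    unfolding irreducible_representation_def by blast
  then have diag: "m v v = r * (v \<bullet> v)" for v
    by (auto simp: p_def set_eq_iff)
  have "m v w = r * (v \<bullet> w)" for v w
    using diag[of "v + w"] diag[of v] diag[of w] m(2)[of w v]
    by (simp add: bilinear_ladd[OF m(1)] bilinear_radd[OF m(1)] inner_add_left inner_add_right
        inner_commute distrib_left)
  then show ?thesis by (rule that)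
qed

section \<open>Orthogonal representations\<close>

lemma representation_inverse:
  assumes "real_representation G T \<rho>" "g \<in> carrier G"
  shows "\<rho> (inv\<^bsub>G\<^esub> g) (\<rho> g v) = v" "\<rho> g (\<rho> (inv\<^bsub>G\<^esub> g) v) = v" "inv\<^bsub>G\<^esub> g \<in> carrier G"
proof -
  interpret group_action G UNIV \<rho>
    using assms(1) by (simp add: real_representation_def)
  interpret group G
    using group_hom by (rule group_hom.axioms(1))
  show "inv\<^bsub>G\<^esub> g \<in> carrier G"
    using assms(2) by simp
  then show "\<rho> (inv\<^bsub>G\<^esub> g) (\<rho> g v) = v" "\<rho> g (\<rho> (inv\<^bsub>G\<^esub> g) v) = v"
    using assms(2) orbit_sym_aux[of g v "\<rho> g v"]
      orbit_sym_aux[of "inv\<^bsub>G\<^esub> g" v "\<rho> (inv\<^bsub>G\<^esub> g) v"]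
    by auto
qed

lemma representation_orthogonal:
  assumes "real_representation G T \<rho>" "invariant_scalar_product G \<rho>" "g \<in> carrier G"
  shows "orthogonal_transformation (\<rho> g)"
  using assms
  by (auto simp: orthogonal_transformation_def real_representation_def
      invariant_scalar_product_def)

lemma representation_image:
  assumes "real_representation G T \<rho>" "g \<in> carrier G"
  shows "\<rho> g ` B = \<rho> (inv\<^bsub>G\<^esub> g) -` B"
  using representation_inverse(1)[OF assms]
  by (auto simp: representation_inverse(2)[OF assms]
      intro!: image_eqI[where x = "\<rho> (inv\<^bsub>G\<^esub> g) _"])

lemma unit_sphere_law_of_invariant:
  assumes "invariant_probability_subspace G \<rho> U \<mu>" "U \<subseteq> sphere 0 1"
  shows "unit_sphere_law \<mu> U"
  using assms
  by (auto simp: invariant_probability_subspace_def radon_probability_on_def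
      unit_sphere_law_def unit_sphere_law_axioms_def)

text \<open>
  The action moves from the vectors \<open>v, w\<close> to the integration variable, where it becomes the inverse
  and is absorbed by the invariance of the law.
\<close>
lemma second_moment_invariant:
  assumes rep: "real_representation G T \<rho>" and scal: "invariant_scalar_product G \<rho>"
    and law: "invariant_probability_subspace G \<rho> U \<mu>" "U \<subseteq> sphere 0 1"
    and g: "g \<in> carrier G"
  shows "second_moment \<mu> (\<rho> g v) (\<rho> g w) = second_moment \<mu> v w"
proof -
  interpret unit_sphere_law \<mu> U
    by (rule unit_sphere_law_of_invariant[OF law])
  define h where "h = \<rho> (inv\<^bsub>G\<^esub> g)"
  have h: "h (\<rho> g x) = x" "\<rho> g (h x) = x" for x
    using representation_inverse[OF rep g] by (auto simp: h_def)
  have orth: "orthogonal_transformation h"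
    using representation_orthogonal[OF rep scal] representation_inverse(3)[OF rep g]
    by (auto simp: h_def)
  have hU: "h x \<in> U" if "x \<in> U" for x
    using law(1) representation_inverse(3)[OF rep g] that
    by (auto simp: h_def invariant_probability_subspace_def invariant_set_def)
  have gU: "\<rho> g x \<in> U" if "x \<in> U" for x
    using law(1) g that by (auto simp: invariant_probability_subspace_def invariant_set_def)
  have "h \<in> borel_measurable borel"
    using orth by (auto simp: orthogonal_transformation_def
        intro!: borel_measurable_continuous_onI linear_continuous_on linear_conv_bounded_linear[THEN iffD1])
  then have "h \<in> measurable \<mu> (restrict_space borel U)"
    by (intro measurable_restrict_space2 borel_measurable_law) (auto simp: space_law hU)
  then have meas: "h \<in> measurable \<mu> \<mu>"
    using measurable_cong_sets[OF refl sets_law] by blast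
  have "distr \<mu> \<mu> h = \<mu>"
  proof (rule measure_eqI)
    fix B assume "B \<in> sets (distr \<mu> \<mu> h)"
    then have B: "B \<in> sets \<mu>" by simp
    then have "B \<subseteq> U"
      using sets.sets_into_space space_law by blast
    then have "h -` B \<inter> space \<mu> = \<rho> g ` B"
      using representation_image[OF rep g, of B] gU by (fastforce simp: space_law h_def)
    then show "emeasure (distr \<mu> \<mu> h) B = emeasure \<mu> B"
      using law(1) g B meas by (simp add: emeasure_distr invariant_probability_subspace_def)
  qed simp
  then have "second_moment \<mu> v w = (\<integral>x. (x \<bullet> v) * (x \<bullet> w) \<partial>distr \<mu> \<mu> h)"
    by (simp add: second_moment_def)
  also have "\<dots> = (\<integral>x. (h x \<bullet> v) * (h x \<bullet> w) \<partial>\<mu>)"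
    by (rule integral_distr[OF meas]) (rule borel_measurable_law, measurable)
  also have "\<dots> = (\<integral>x. (x \<bullet> \<rho> g v) * (x \<bullet> \<rho> g w) \<partial>\<mu>)"
    using orth h(1) by (metis (no_types) orthogonal_transformation_def)
  finally show ?thesis
    by (simp add: second_moment_def)
qed

section \<open>Lebesgue measure and orthogonal maps\<close>

text \<open>
  By Vitali's covering theorem an open set is, up to a null set, a countable disjoint union of
  balls. An orthogonal map sends these to disjoint balls of the same volume.
\<close>
lemma emeasure_lborel_open_le_image:
  fixes f :: "'v::euclidean_space \<Rightarrow> 'v"
  assumes f: "orthogonal_transformation f" and S: "open S" "open (f ` S)"
  shows "emeasure lborel S \<le> emeasure lborel (f ` S)"
proof -
  define K where "K = {(a, r). ball a r \<subseteq> S}"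
  have "\<exists>i. i \<in> K \<and> x \<in> ball (fst i) (snd i) \<and> snd i < e" if x: "x \<in> S" and e: "0 < e" for x e
  proof -
    obtain s where s: "s > 0" "ball x s \<subseteq> S"
      using S(1) x by (auto simp: open_contains_ball)
    have "(x, min s (e / 2)) \<in> K"
      using s by (auto simp: K_def)
    then show ?thesis
      using s e by (intro exI[of _ "(x, min s (e / 2))"]) auto
  qed
  then obtain C where C: "countable C" "C \<subseteq> K"
    and disj: "pairwise (\<lambda>i j. disjnt (ball (fst i) (snd i)) (ball (fst j) (snd j))) C"
    and neg: "negligible (S - (\<Union>i\<in>C. ball (fst i) (snd i)))"
    using Vitali_covering_theorem_balls[of S K fst snd] by blast
  define D where "D = (\<Union>i\<in>C. ball (fst i) (snd i))"
  have D: "D \<subseteq> S" "open D"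
    using C(2) by (fastforce simp: D_def K_def)+
  have inj: "inj f"
    using f by (rule orthogonal_transformation_inj)
  have disj': "disjoint_family_on (\<lambda>i. ball (fst i) (snd i)) C"
    using disj by (auto simp: disjoint_family_on_def pairwise_def disjnt_def)
  have fball: "f ` ball a r = ball (f a) r" for a r
    by (rule image_orthogonal_transformation_ball[OF f])
  have disj'': "disjoint_family_on (\<lambda>i. ball (f (fst i)) (snd i)) C"
    unfolding disjoint_family_on_def
  proof (intro ballI impI)
    fix i j assume "i \<in> C" "j \<in> C" "i \<noteq> j"
    then have "f ` (ball (fst i) (snd i) \<inter> ball (fst j) (snd j)) = {}"
      using disj' by (auto simp: disjoint_family_on_def)
    then show "ball (f (fst i)) (snd i) \<inter> ball (f (fst j)) (snd j) = {}"
      by (simp only: image_Int[OF inj] fball)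
  qed
  have vol: "emeasure lborel (ball (f a) r) = emeasure lborel (ball a r)" for a r
    by (cases "r \<ge> 0") (auto simp: emeasure_ball ball_empty)
  have "emeasure lborel (S - D) = 0"
  proof -
    have "S - D \<in> null_sets lebesgue"
      using neg by (simp add: D_def negligible_iff_null_sets)
    then have "emeasure lebesgue (S - D) = 0" by auto
    then show ?thesis
      using S(1) D(2) by (simp add: emeasure_completion)
  qed
  then have "emeasure lborel S = emeasure lborel D"
    using S(1) D emeasure_Diff_null_set[of "S - D" lborel S]
    by (simp add: double_diff null_sets_def Diff_Diff_Int Int_absorb1)
  also have "\<dots> = (\<integral>\<^sup>+i. emeasure lborel (ball (fst i) (snd i)) \<partial>count_space C)"
    unfolding D_def by (rule emeasure_UN_countable) (use C(1) disj' in auto)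
  also have "\<dots> = (\<integral>\<^sup>+i. emeasure lborel (ball (f (fst i)) (snd i)) \<partial>count_space C)"
    by (simp add: vol)
  also have "\<dots> = emeasure lborel (\<Union>i\<in>C. ball (f (fst i)) (snd i))"
    by (rule emeasure_UN_countable[symmetric]) (use C(1) disj'' in auto)
  also have "\<dots> = emeasure lborel (f ` D)"
    by (simp add: D_def image_UN fball)
  also have "\<dots> \<le> emeasure lborel (f ` S)"
    using D(1) S(2) by (intro emeasure_mono image_mono) auto
  finally show ?thesis .
qed

text \<open>
  Comparing volumes of open sets along \<open>f\<close> and along its inverse gives equality for open sets, in
  particular for boxes, and boxes determine Lebesgue measure.
\<close>
lemma emeasure_lborel_orthogonal_vimage:
  fixes f :: "'v::euclidean_space \<Rightarrow> 'v"
  assumes f: "orthogonal_transformation f" and X: "X \<in> sets borel"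
  shows "emeasure lborel (f -` X) = emeasure lborel X"
proof -
  have bij: "bij f"
    by (rule orthogonal_transformation_bij[OF f])
  have cont: "continuous_on UNIV f"
    using f by (auto simp: orthogonal_transformation_def
        intro!: linear_continuous_on linear_conv_bounded_linear[THEN iffD1])
  then have meas: "f \<in> borel_measurable borel"
    by (rule borel_measurable_continuous_onI)
  have open_eq: "emeasure lborel (f -` S) = emeasure lborel S" if S: "open S" for S
  proof (rule antisym)
    have V: "open (f -` S)"
      using cont S by (simp add: continuous_on_open_vimage)
    have im: "f ` (f -` S) = S" "inv_into UNIV f ` S = f -` S"
      using bij surj_image_vimage_eq[of f S] bij_vimage_eq_inv_image[of f S]
      by (auto simp: bij_is_surj)
    show "emeasure lborel (f -` S) \<le> emeasure lborel S"
      using emeasure_lborel_open_le_image[OF f V] S im by simp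
    show "emeasure lborel S \<le> emeasure lborel (f -` S)"
      using emeasure_lborel_open_le_image[OF orthogonal_transformation_inv[OF f] S] V im by simp
  qed
  have "lborel = distr lborel borel f"
  proof (rule lborel_eqI)
    fix l u :: 'v assume "\<And>b. b \<in> Basis \<Longrightarrow> l \<bullet> b \<le> u \<bullet> b"
    then show "emeasure (distr lborel borel f) (box l u) = (\<Prod>b\<in>Basis. (u - l) \<bullet> b)"
      using meas by (simp add: emeasure_distr open_eq open_box)
  qed simp
  then have "emeasure lborel X = emeasure (distr lborel borel f) X"
    by simp
  then show ?thesis
    using meas X by (simp add: emeasure_distr)
qed

section \<open>An invariant law on the unit sphere of an invariant subspace\<close>

text \<open>
  The nearest point of \<open>W\<close> is characterised by the metric alone, and the representation acts on \<open>W\<close>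
  by isometries whose inverses also preserve \<open>W\<close>.
\<close>
lemma closest_point_equivariant:
  assumes rep: "real_representation G T \<rho>" and scal: "invariant_scalar_product G \<rho>"
    and W: "subspace W" "invariant_set G \<rho> W" and g: "g \<in> carrier G"
  shows "closest_point W (\<rho> g x) = \<rho> g (closest_point W x)"
proof (rule sym, rule closest_point_unique)
  have ne: "W \<noteq> {}" and cl: "closed W"
    using W(1) subspace_0 by (auto simp: closed_subspace)
  show "convex W" "closed W"
    using W(1) by (auto simp: subspace_imp_convex closed_subspace)
  show "\<rho> g (closest_point W x) \<in> W"
    using closest_point_in_set[OF cl ne] W(2) g by (auto simp: invariant_set_def)
  have dist: "dist (\<rho> g u) (\<rho> g v) = dist u v" for u v
    using representation_orthogonal[OF rep scal g] by (simp add: orthogonal_transformation_isometry)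
  show "\<forall>z\<in>W. dist (\<rho> g x) (\<rho> g (closest_point W x)) \<le> dist (\<rho> g x) z"
  proof
    fix z assume z: "z \<in> W"
    let ?z = "\<rho> (inv\<^bsub>G\<^esub> g) z"
    have "?z \<in> W"
      using z W(2) representation_inverse(3)[OF rep g] by (auto simp: invariant_set_def)
    then have "dist x (closest_point W x) \<le> dist x ?z"
      by (rule closest_point_le[OF cl])
    then show "dist (\<rho> g x) (\<rho> g (closest_point W x)) \<le> dist (\<rho> g x) z"
      using dist[of x ?z] representation_inverse(2)[OF rep g, of z] by (simp add: dist)
  qed
qed

text \<open>
  A uniformly distributed point of the unit ball is projected to \<open>W\<close> and then normalised. The law
  of the result is invariant, because orthogonal maps preserve volume and the projection to an
  invariant subspace is equivariant. Conditioning on the projection being nonzero makes the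
  normalisation meaningful.
\<close>
lemma invariant_law_on_subspace_sphere:
  fixes \<rho> :: "'g \<Rightarrow> 'v::euclidean_space \<Rightarrow> 'v"
  assumes rep: "real_representation G T \<rho>" and scal: "invariant_scalar_product G \<rho>"
    and W: "subspace W" "invariant_set G \<rho> W" "W \<noteq> {0}"
  obtains \<mu> where "invariant_probability_subspace G \<rho> (sphere 0 1 \<inter> W) \<mu>"
proof -
  define U where "U = sphere 0 1 \<inter> W"
  define P where "P = closest_point W"
  define D where "D = {x. norm x < 1 \<and> P x \<noteq> 0}"
  define \<pi> where "\<pi> x = P x /\<^sub>R norm (P x)" for x
  define \<kappa> where "\<kappa> = uniform_measure lborel D"
  define \<nu> where "\<nu> = distr \<kappa> borel \<pi>"
  define \<mu> where "\<mu> = restrict_space \<nu> U"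
  have clW: "closed W" and neW: "W \<noteq> {}" and cvW: "convex W"
    using W(1) subspace_0 by (auto simp: closed_subspace subspace_imp_convex)
  have PW: "P x \<in> W" for x
    using closest_point_in_set[OF clW neW] by (simp add: P_def)
  have contP: "continuous_on UNIV P"
    unfolding P_def by (rule continuous_on_closest_point[OF cvW clW neW])
  then have [measurable]: "P \<in> borel_measurable borel"
    by (rule borel_measurable_continuous_onI)
  have [measurable]: "\<pi> \<in> borel_measurable borel"
    unfolding \<pi>_def by measurable
  have openD: "open D"
    unfolding D_def using contP
    by (intro open_Collect_conj open_Collect_less open_Collect_neq continuous_intros) auto
  obtain w where w: "w \<in> W" "w \<noteq> 0"
    using W(1,3) subspace_0 by blast
  \<comment> \<open>A vector of \<open>W\<close> of norm \<open>1 / 2\<close> lies in \<open>D\<close>; so the open set \<open>D\<close> has positive volume.\<close>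
  define w' where "w' = (1 / (2 * norm w)) *\<^sub>R w"
  have "w' \<in> W"
    using w W(1) by (simp add: w'_def subspace_scale)
  then have "P w' = w'"
    by (simp add: P_def closest_point_self)
  then have "w' \<in> D"
    using w by (simp add: D_def w'_def)
  then have D0: "emeasure lborel D \<noteq> 0"
    using open_not_negligible[OF openD] openD
    by (auto simp: negligible_iff_emeasure0 emeasure_completion)
  have "emeasure lborel D \<le> emeasure lborel (ball (0::'v) 1)"
    by (rule emeasure_mono) (auto simp: D_def)
  also have "\<dots> < \<infinity>"
    by (simp add: emeasure_ball)
  finally have Dfin: "emeasure lborel D \<noteq> \<infinity>" by simp
  have [measurable]: "D \<in> sets borel"
    using openD by simp
  interpret L: prob_space \<kappa>
    unfolding \<kappa>_def by (rule prob_space_uniform_measure[OF D0 Dfin])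
  have sets_\<kappa> [simp, measurable_cong]: "sets \<kappa> = sets borel"
    by (simp add: \<kappa>_def)
  interpret N: prob_space \<nu>
    unfolding \<nu>_def by (rule L.prob_space_distr) measurable
  have sets_\<nu> [simp]: "sets \<nu> = sets borel" and space_\<nu> [simp]: "space \<nu> = UNIV"
    by (auto simp: \<nu>_def)
  have \<nu>: "emeasure \<nu> B = emeasure lborel (D \<inter> \<pi> -` B) / emeasure lborel D" if "B \<in> sets borel" for B
  proof -
    have "\<pi> -` B \<in> sets borel"
      using measurable_sets[OF \<open>\<pi> \<in> borel_measurable borel\<close> that] by simp
    then show ?thesis
      using that by (simp add: \<nu>_def emeasure_distr \<kappa>_def)
  qed
  have compU: "compact U"
    unfolding U_def using clW by (intro compact_Int_closed) auto
  then have borelU: "U \<in> sets borel"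
    by (simp add: borel_compact)
  have "\<pi> x \<in> U" if "x \<in> D" for x
    using that PW[of x] W(1) by (auto simp: U_def \<pi>_def D_def subspace_scale)
  then have "D \<inter> \<pi> -` U = D" by auto
  then have "emeasure \<nu> U = 1"
    using \<nu>[OF borelU] D0 Dfin by (simp add: ennreal_divide_self less_top)
  then have prob: "prob_space \<mu>"
    unfolding \<mu>_def by (intro prob_space_restrict_space) (auto simp: borelU)
  have sets_\<mu>: "sets \<mu> = sets (restrict_space borel U)"
    by (simp add: \<mu>_def sets_restrict_space)
  have in_\<mu>: "B \<in> sets \<mu> \<longleftrightarrow> B \<subseteq> U \<and> B \<in> sets borel" for B
    using borelU by (simp add: sets_\<mu> sets_restrict_space_iff)
  have em_\<mu>: "emeasure \<mu> B = emeasure \<nu> B" if "B \<subseteq> U" for B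
    unfolding \<mu>_def by (rule emeasure_restrict_space) (use borelU that in auto)
  have radon: "radon_probability_on U \<mu>"
    unfolding radon_probability_on_def
  proof (intro conjI ballI)
    fix B assume B: "B \<in> sets \<mu>"
    then have "emeasure \<mu> B = emeasure \<nu> B"
      by (simp add: em_\<mu> in_\<mu>)
    also have "\<dots> = (SUP K\<in>{K. K \<subseteq> B \<and> compact K}. emeasure \<nu> K)"
      by (rule inner_regular) (use B in_\<mu> in auto)
    also have "\<dots> = (SUP K\<in>{K. compact K \<and> K \<subseteq> B}. emeasure \<mu> K)"
      using B by (intro SUP_cong) (auto simp: in_\<mu> intro!: em_\<mu>[symmetric])
    finally show "emeasure \<mu> B = (SUP K\<in>{K. compact K \<and> K \<subseteq> B}. emeasure \<mu> K)" .
  qed (use sets_\<mu> prob in auto)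
  have invU: "invariant_set G \<rho> U"
    unfolding invariant_set_def
  proof (intro ballI)
    fix g u assume "g \<in> carrier G" "u \<in> U"
    then show "\<rho> g u \<in> U"
      using W(2) orthogonal_transformation_norm[OF representation_orthogonal[OF rep scal]]
      by (auto simp: U_def invariant_set_def)
  qed
  have "emeasure \<mu> (\<rho> g ` B) = emeasure \<mu> B" if g: "g \<in> carrier G" and B: "B \<in> sets \<mu>" for g B
  proof -
    define h where "h = \<rho> (inv\<^bsub>G\<^esub> g)"
    have g': "inv\<^bsub>G\<^esub> g \<in> carrier G"
      by (rule representation_inverse(3)[OF rep g])
    have orth: "orthogonal_transformation h"
      unfolding h_def by (rule representation_orthogonal[OF rep scal g'])
    then have lin: "linear h" and norm: "\<And>x. norm (h x) = norm x"
      by (auto simp: orthogonal_transformation)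
    have [measurable]: "h \<in> borel_measurable borel"
      using lin by (intro borel_measurable_continuous_onI linear_continuous_on)
        (simp add: linear_conv_bounded_linear)
    have Ph: "P (h x) = h (P x)" for x
      unfolding P_def h_def by (rule closest_point_equivariant[OF rep scal W(1,2) g'])
    have "h y = 0 \<longleftrightarrow> y = 0" for y
      using norm[of y] by (metis norm_eq_zero)
    then have "h x \<in> D \<longleftrightarrow> x \<in> D" for x
      by (simp add: D_def Ph norm)
    moreover have "\<pi> (h x) = h (\<pi> x)" for x
      by (simp add: \<pi>_def Ph norm linear_cmul[OF lin])
    ultimately have eq: "D \<inter> \<pi> -` (h -` B) = h -` (D \<inter> \<pi> -` B)"
      by auto
    have borelB: "B \<in> sets borel" and BU: "B \<subseteq> U"
      using B in_\<mu> by auto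
    have hB: "h -` B \<in> sets borel"
      using measurable_sets[OF \<open>h \<in> borel_measurable borel\<close> borelB] by simp
    have piB: "D \<inter> \<pi> -` B \<in> sets borel"
      using measurable_sets[OF \<open>\<pi> \<in> borel_measurable borel\<close> borelB] by simp
    have im: "\<rho> g ` B = h -` B"
      unfolding h_def by (rule representation_image[OF rep g])
    have "\<rho> g ` B \<subseteq> U"
      using BU invU g by (auto simp: invariant_set_def)
    then have "emeasure \<mu> (\<rho> g ` B) = emeasure \<nu> (h -` B)"
      by (simp add: em_\<mu> im)
    also have "\<dots> = emeasure lborel (D \<inter> \<pi> -` B) / emeasure lborel D"
      by (simp only: \<nu>[OF hB] eq emeasure_lborel_orthogonal_vimage[OF orth piB])
    also have "\<dots> = emeasure \<mu> B"
      by (simp add: \<nu>[OF borelB] em_\<mu>[OF BU])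
    finally show ?thesis .
  qed
  then have "invariant_probability_subspace G \<rho> U \<mu>"
    using invU radon by (simp add: invariant_probability_subspace_def)
  then show ?thesis
    using that by (simp add: U_def)
qed

section \<open>The irreducibility criterion\<close>

lemma independent_copies:
  assumes "prob_space \<mu>"
  shows "independent_invariant_random_vectors (\<mu> \<Otimes>\<^sub>M \<mu>) \<mu> fst snd"
proof -
  interpret prob_space \<mu> by fact
  interpret P: pair_prob_space \<mu> \<mu> ..
  have snd: "distr (\<mu> \<Otimes>\<^sub>M \<mu>) \<mu> snd = \<mu>"
  proof (rule measure_eqI)
    fix A assume "A \<in> sets (distr (\<mu> \<Otimes>\<^sub>M \<mu>) \<mu> snd)"
    then have A: "A \<in> sets \<mu>" by simp
    then have "snd -` A \<inter> space (\<mu> \<Otimes>\<^sub>M \<mu>) = space \<mu> \<times> A"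
      using sets.sets_into_space by (auto simp: space_pair_measure)
    then show "emeasure (distr (\<mu> \<Otimes>\<^sub>M \<mu>) \<mu> snd) A = emeasure \<mu> A"
      using A by (simp add: emeasure_distr emeasure_pair_measure_Times emeasure_space_1)
  qed simp
  show ?thesis
    unfolding independent_invariant_random_vectors_def invariant_random_vector_def
      P.indep_var_distribution_eq
    using P.prob_space_axioms by (auto simp: distr_pair_fst snd distr_id)
qed

lemma expectation_ge_of_invariant:
  fixes \<rho> :: "'g \<Rightarrow> 'v::euclidean_space \<Rightarrow> 'v"
  assumes "invariant_probability_subspace G \<rho> U \<mu>" "U \<subseteq> sphere 0 1"
    and W: "subspace W" "U \<subseteq> W"
    and ind: "independent_invariant_random_vectors M \<mu> X Y"
  shows "1 / real (dim W) \<le> prob_space.expectation M (\<lambda>\<omega>. (X \<omega> \<bullet> Y \<omega>)\<^sup>2)"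
proof -
  interpret unit_sphere_law \<mu> U
    by (rule unit_sphere_law_of_invariant) fact+
  obtain B where B: "pairwise orthogonal B" "\<And>b. b \<in> B \<Longrightarrow> norm b = 1" "independent B"
    "card B = dim W" "span B = W"
    using orthonormal_basis_subspace[OF W(1)] by metis
  then show ?thesis
    using expectation_inner_squared_ge[of B M X Y] W(2) ind independent_imp_finite[OF B(3)] by simp
qed

lemma expectation_eq_of_irreducible:
  fixes \<rho> :: "'g \<Rightarrow> 'v::euclidean_space \<Rightarrow> 'v"
  assumes rep: "real_representation G T \<rho>" and scal: "invariant_scalar_product G \<rho>"
    and irr: "irreducible_representation G \<rho>"
    and law: "invariant_probability_subspace G \<rho> U \<mu>" "U \<subseteq> sphere 0 1"
    and ind: "independent_invariant_random_vectors M \<mu> X Y"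
  shows "prob_space.expectation M (\<lambda>\<omega>. (X \<omega> \<bullet> Y \<omega>)\<^sup>2) = 1 / real DIM('v)"
proof -
  interpret unit_sphere_law \<mu> U
    by (rule unit_sphere_law_of_invariant[OF law])
  obtain r where "\<And>v w. second_moment \<mu> v w = r * (v \<bullet> w)"
    using invariant_form_proportional_to_inner[OF irr scal bilinear_second_moment
        second_moment_commute second_moment_invariant[OF rep scal law]] by metis
  then show ?thesis
    using ind by (rule expectation_inner_squared_isotropic)
qed

text \<open>
  The law lives on the sphere of the smaller space \<open>W\<close>, where the lower bound is \<open>1 / dim W\<close>.
\<close>
lemma expectation_gt_of_invariant_subspace:
  fixes \<rho> :: "'g \<Rightarrow> 'v::euclidean_space \<Rightarrow> 'v"
  assumes rep: "real_representation G T \<rho>" and scal: "invariant_scalar_product G \<rho>"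
    and W: "subspace W" "invariant_set G \<rho> W" "0 < dim W" "dim W < DIM('v)"
  shows "\<exists>U \<mu> (M :: ('v \<times> 'v) measure) x y.
    invariant_probability_subspace G \<rho> U \<mu> \<and> U \<subseteq> sphere 0 1 \<and>
    independent_invariant_random_vectors M \<mu> x y \<and>
    prob_space.expectation M (\<lambda>\<omega>. (x \<omega> \<bullet> y \<omega>)\<^sup>2) > 1 / real DIM('v)"
proof -
  have "W \<noteq> {0}"
    using W(3) by auto
  then obtain \<mu> where \<mu>: "invariant_probability_subspace G \<rho> (sphere 0 1 \<inter> W) \<mu>"
    using invariant_law_on_subspace_sphere[OF rep scal W(1,2)] by blast
  then have ind: "independent_invariant_random_vectors (\<mu> \<Otimes>\<^sub>M \<mu>) \<mu> fst snd"
    by (intro independent_copies)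
      (simp add: invariant_probability_subspace_def radon_probability_on_def)
  have "1 / real DIM('v) < 1 / real (dim W)"
    using W(3,4) by (simp add: divide_strict_left_mono)
  also have "\<dots> \<le> prob_space.expectation (\<mu> \<Otimes>\<^sub>M \<mu>) (\<lambda>\<omega>. (fst \<omega> \<bullet> snd \<omega>)\<^sup>2)"
    by (rule expectation_ge_of_invariant[OF \<mu> _ W(1) _ ind]) auto
  finally show ?thesis
    using \<mu> ind by blast
qed

lemma reducible_obtains_proper_subspace:
  fixes \<rho> :: "'g \<Rightarrow> 'v::euclidean_space \<Rightarrow> 'v"
  assumes "\<not> irreducible_representation G \<rho>"
  obtains W where "subspace W" "invariant_set G \<rho> W" "0 < dim W" "dim W < DIM('v)"
proof -
  have "(UNIV :: 'v set) \<noteq> {0}"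
    by (rule UNIV_not_singleton)
  then obtain W where W: "subspace W" "invariant_set G \<rho> W" "W \<noteq> {0}" "W \<noteq> UNIV"
    using assms by (auto simp: irreducible_representation_def)
  have "dim W \<noteq> 0"
    using W(1,3) subspace_0 by (auto simp: dim_eq_0)
  moreover have "dim W \<noteq> DIM('v)"
    using W(1,4) by (metis dim_eq_full span_eq_iff)
  ultimately show ?thesis
    using that[OF W(1,2)] dim_subset_UNIV[of W] by linarith
qed

theorem theorem1p1:
  fixes G :: "('g, 'm) monoid_scheme"
    and T :: "'g topology"
    and A :: "'g chart set"
    and d :: nat
    and \<rho> :: "'g \<Rightarrow> 'v::euclidean_space \<Rightarrow> 'v"
  assumes "compact_lie_group d G T A"
    and "real_representation G T \<rho>"
    and "invariant_scalar_product G \<rho>"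
  shows
    "(\<forall>U \<mu> (M :: 'w measure) x y.
        invariant_probability_subspace G \<rho> U \<mu> \<and> U \<subseteq> sphere 0 1 \<and>
        independent_invariant_random_vectors M \<mu> x y \<longrightarrow>
        prob_space.expectation M (\<lambda>\<omega>. (x \<omega> \<bullet> y \<omega>)\<^sup>2) \<ge> 1 / real DIM('v)) \<and>
     (irreducible_representation G \<rho> \<longrightarrow>
      (\<forall>U \<mu> (M :: 'w measure) x y.
        invariant_probability_subspace G \<rho> U \<mu> \<and> U \<subseteq> sphere 0 1 \<and>
        independent_invariant_random_vectors M \<mu> x y \<longrightarrow>
        prob_space.expectation M (\<lambda>\<omega>. (x \<omega> \<bullet> y \<omega>)\<^sup>2) = 1 / real DIM('v))) \<and>
     ((\<exists>W. subspace W \<and> invariant_set G \<rho> W \<and> 0 < dim W \<and> dim W < DIM('v)) \<longrightarrow>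
      (\<exists>U \<mu> (M :: ('v \<times> 'v) measure) x y.
        invariant_probability_subspace G \<rho> U \<mu> \<and> U \<subseteq> sphere 0 1 \<and>
        independent_invariant_random_vectors M \<mu> x y \<and>
        prob_space.expectation M (\<lambda>\<omega>. (x \<omega> \<bullet> y \<omega>)\<^sup>2) > 1 / real DIM('v))) \<and>
     (irreducible_representation G \<rho> \<longleftrightarrow>
      (\<forall>U \<mu> (M :: ('v \<times> 'v) measure) x y.
        invariant_probability_subspace G \<rho> U \<mu> \<and> U \<subseteq> sphere 0 1 \<and>
        independent_invariant_random_vectors M \<mu> x y \<longrightarrow>
        prob_space.expectation M (\<lambda>\<omega>. (x \<omega> \<bullet> y \<omega>)\<^sup>2) = 1 / real DIM('v)))"
proof (intro conjI allI impI)
  note rep = assms(2) and scal = assms(3)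
  show "1 / real DIM('v) \<le> prob_space.expectation M (\<lambda>\<omega>. (x \<omega> \<bullet> y \<omega>)\<^sup>2)"
    if "invariant_probability_subspace G \<rho> U \<mu> \<and> U \<subseteq> sphere 0 1 \<and>
      independent_invariant_random_vectors M \<mu> x y" for U \<mu> x y and M :: "'w measure"
    using that expectation_ge_of_invariant[of G \<rho> U \<mu> UNIV M x y] by (simp add: dim_UNIV)
  show "prob_space.expectation M (\<lambda>\<omega>. (x \<omega> \<bullet> y \<omega>)\<^sup>2) = 1 / real DIM('v)"
    if "irreducible_representation G \<rho>" "invariant_probability_subspace G \<rho> U \<mu> \<and>
      U \<subseteq> sphere 0 1 \<and> independent_invariant_random_vectors M \<mu> x y"
    for U \<mu> x y and M :: "'w measure"
    using that(2) expectation_eq_of_irreducible[OF rep scal that(1), of U \<mu> M x y] by simp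
  show "\<exists>U \<mu> (M :: ('v \<times> 'v) measure) x y.
      invariant_probability_subspace G \<rho> U \<mu> \<and> U \<subseteq> sphere 0 1 \<and>
      independent_invariant_random_vectors M \<mu> x y \<and>
      prob_space.expectation M (\<lambda>\<omega>. (x \<omega> \<bullet> y \<omega>)\<^sup>2) > 1 / real DIM('v)"
    if "\<exists>W. subspace W \<and> invariant_set G \<rho> W \<and> 0 < dim W \<and> dim W < DIM('v)"
    using that expectation_gt_of_invariant_subspace[OF rep scal] by blast
  show "irreducible_representation G \<rho> \<longleftrightarrow>
    (\<forall>U \<mu> (M :: ('v \<times> 'v) measure) x y.
      invariant_probability_subspace G \<rho> U \<mu> \<and> U \<subseteq> sphere 0 1 \<and>
      independent_invariant_random_vectors M \<mu> x y \<longrightarrow>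
      prob_space.expectation M (\<lambda>\<omega>. (x \<omega> \<bullet> y \<omega>)\<^sup>2) = 1 / real DIM('v))"
    (is "_ \<longleftrightarrow> ?const")
  proof
    show ?const if "irreducible_representation G \<rho>"
      by (intro allI impI, elim conjE) (rule expectation_eq_of_irreducible[OF rep scal that])
    show "irreducible_representation G \<rho>" if const: ?const
    proof (rule ccontr)
      assume "\<not> irreducible_representation G \<rho>"
      then obtain W where "subspace W" "invariant_set G \<rho> W" "0 < dim W" "dim W < DIM('v)"
        by (rule reducible_obtains_proper_subspace)
      from expectation_gt_of_invariant_subspace[OF rep scal this] const show False
        by fastforce
    qed
  qed
qed

end
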